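(* Let $G$ be a finite graph and let $\mathrm{cc}(G)$ denote the maximum length of a cycle chain contained in $G$. Let $f:\mathbb{R}\to\mathbb{R}$ be a non-constant odd real-analytic function, and suppose that $f$ is either periodic or has finite fibers. Then $$\dim X_{G,f}\leq \dim \mathrm{H}_1(G)-\mathrm{cc}(G)+1.$$
   Context: $G$ is a finite simple undirected graph with vertex set $V$. A cycle chain of length $p$ is a sequence of cycle graphs $G_1,\ldots,G_p$ such that $|E(G_j)\cap E(G_k)|=1$ if $|j-k|=1$ and $E(G_j)\cap E(G_k)=\emptyset$ if $|j-k|>1$; it is contained in $G$ if every $G_j$ is a subgraph of $G$. The function $f$ has finite fibers if $f^{-1}(\{x\})$ is a finite set for every $x\in\mathbb{R}$. Fix an arbitrary orientation of each edge of $G$ and let $E\subseteq V\times V$ be the set of oriented edges. The incidence matrix $B:\mathbb{R}^E\to\mathbb{R}^V$ has entries $b_{i,(j,k)}=\delta_{ik}-\delta_{ij}$. Set $\mathrm{H}_0(G)=\mathrm{Ker}(B^{\mathsf T})\subseteq\mathbb{R}^V$ and $\mathrm{H}_1(G)=\mathrm{Ker}(B)\subseteq\mathbb{R}^E$. Let $\mathbf{f}:\mathbb{R}^E\to\mathbb{R}^E$ apply $f$ to each component, and define $$X_{G,f}=\mathbf{f}^{-1}(\mathrm{H}_1(G))\cap \mathrm{H}_1(G)^\perp\subseteq\mathbb{R}^E.$$ This is the set of equilibria, up to translations by $\mathrm{H}_0(G)$, of the system $\dot x_i=\sum_{j\in N(i)}f(x_j-x_i)$, $i\in V$. The set $X_{G,f}$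 is real-analytic, and $\dim X_{G,f}$ is the maximum dimension of a manifold contained in it. *)

theory Defs
  imports "HOL-Analysis.Analysis"
begin

section \<open>Graphs and cycle chains\<close>

text \<open>
  The vertex set is a finite type, so a graph is given by its set of undirected edges.
  A cycle graph has no isolated vertices; it is therefore determined by its edge set, and it is a
  subgraph of a graph iff its edge set is a subset.
\<close>

definition simple_graph :: "'v::finite set set \<Rightarrow> bool" where
  "simple_graph G \<longleftrightarrow> (\<forall>e\<in>G. card e = 2)"

definition cycle_graph :: "'v set set \<Rightarrow> bool" where
  "cycle_graph C \<longleftrightarrow>
     (\<exists>vs. distinct vs \<and> length vs \<ge> 3 \<and>
           C = {{vs ! i, vs ! (Suc i mod length vs)} | i. i < length vs})"

definition cycle_chain :: "'v set set list \<Rightarrow> bool" where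
  "cycle_chain Cs \<longleftrightarrow>
     (\<forall>C\<in>set Cs. cycle_graph C) \<and>
     (\<forall>j<length Cs. \<forall>k<length Cs.
        (\<bar>int j - int k\<bar> = 1 \<longrightarrow> card (Cs ! j \<inter> Cs ! k) = 1) \<and>
        (\<bar>int j - int k\<bar> > 1 \<longrightarrow> Cs ! j \<inter> Cs ! k = {}))"

text \<open>
  The empty sequence is a cycle chain of length 0, so \<open>cc G = 0\<close> for a forest. The set of lengths
  is finite, since the cycles in a chain are pairwise distinct.
\<close>

definition cc :: "'v::finite set set \<Rightarrow> nat" where
  "cc G = Max {length Cs | Cs. cycle_chain Cs \<and> (\<forall>C\<in>set Cs. C \<subseteq> G)}"

section \<open>Orientations, incidence matrix, and equilibria\<close>

definition orientation :: "'v set set \<Rightarrow> ('v \<times> 'v) set \<Rightarrow> bool" where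
  "orientation G E \<longleftrightarrow> bij_betw (\<lambda>(j, k). {j, k}) E G"

text \<open>
  The space of real vectors indexed by the oriented edges \<open>E\<close> is the subspace of vectors indexed by
  all pairs of vertices whose components outside \<open>E\<close> vanish. Accordingly, the columns of the
  incidence matrix outside \<open>E\<close> are zero, and kernels and orthogonal complements are taken inside
  this subspace.
\<close>

definition edge_space :: "('v::finite \<times> 'v) set \<Rightarrow> (real ^ ('v \<times> 'v)) set" where
  "edge_space E = {x. \<forall>e. e \<notin> E \<longrightarrow> x $ e = 0}"

definition incidence_matrix :: "('v::finite \<times> 'v) set \<Rightarrow> real ^ ('v \<times> 'v) ^ 'v" where
  "incidence_matrix E =
     (\<chi> i e. if e \<in> E then of_bool (i = snd e) - of_bool (i = fst e) else 0)"

definition H1 :: "('v::finite \<times> 'v) set \<Rightarrow> (real ^ ('v \<times> 'v)) set" where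
  "H1 E = {x \<in> edge_space E. incidence_matrix E *v x = 0}"

definition edgewise ::
    "('v::finite \<times> 'v) set \<Rightarrow> (real \<Rightarrow> real) \<Rightarrow> real ^ ('v \<times> 'v) \<Rightarrow> real ^ ('v \<times> 'v)" where
  "edgewise E f x = (\<chi> e. if e \<in> E then f (x $ e) else 0)"

definition equilibria ::
    "('v::finite \<times> 'v) set \<Rightarrow> (real \<Rightarrow> real) \<Rightarrow> (real ^ ('v \<times> 'v)) set" where
  "equilibria E f = {x \<in> edge_space E. edgewise E f x \<in> H1 E \<and> x \<in> (H1 E)\<^sup>\<bottom>}"

section \<open>Dimension\<close>

text \<open>
  A manifold contained in a subset of Euclidean space is a nonempty subset that is locally Euclidean
  in the subspace topology; the Hausdorff and second countability axioms are then automatic.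
  On real-analytic sets, smooth, real-analytic and topological manifolds yield the same maximum
  dimension.
\<close>

definition manifold_of_dim :: "nat \<Rightarrow> 'a::euclidean_space set \<Rightarrow> bool" where
  "manifold_of_dim d M \<longleftrightarrow> M \<noteq> {} \<and>
     (\<forall>x\<in>M. \<exists>U W. x \<in> U \<and> openin (top_of_set M) U \<and> openin (Euclidean_space d) W \<and>
        top_of_set U homeomorphic_space subtopology (Euclidean_space d) W)"

text \<open>
  By invariance of domain, the dimensions occurring here are bounded by the dimension of the
  ambient space; if \<open>X\<close> is nonempty, 0 is among them.
\<close>

definition manifold_dim :: "'a::euclidean_space set \<Rightarrow> nat" where
  "manifold_dim X = Max {d. \<exists>M. M \<subseteq> X \<and> manifold_of_dim d M}"

section \<open>Properties of the coupling function\<close>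

definition real_analytic :: "(real \<Rightarrow> real) \<Rightarrow> bool" where
  "real_analytic f \<longleftrightarrow> (\<forall>x. \<exists>F. (\<lambda>h. f (x + h)) has_fps_expansion F)"

definition odd_function :: "(real \<Rightarrow> real) \<Rightarrow> bool" where
  "odd_function f \<longleftrightarrow> (\<forall>x. f (- x) = - f x)"

definition periodic_function :: "(real \<Rightarrow> real) \<Rightarrow> bool" where
  "periodic_function f \<longleftrightarrow> (\<exists>T>0. \<forall>x. f (x + T) = f x)"

definition finite_fibers :: "(real \<Rightarrow> real) \<Rightarrow> bool" where
  "finite_fibers f \<longleftrightarrow> (\<forall>x. finite (f -` {x}))"

end

theory Submission
  imports Defs "HOL-Homology.Invariance_of_Domain"
begin

text \<open>
  Let \<open>M\<close> be a manifold contained in the equilibria, and let \<open>c 0, \<dots>, c (p - 1)\<close> be the cycle vectors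
  of a cycle chain, with \<open>s i\<close> the edge shared by the cycles \<open>i\<close> and \<open>i + 1\<close>. Since the critical
  points of \<open>f\<close> are isolated, after shrinking \<open>M\<close> the function \<open>f\<close> is injective on the values of each
  coordinate. Then \<open>x\<close> is determined by the class of the flow \<open>y = f x\<close> modulo
  \<open>span {c 1, \<dots>, c (p - 1)}\<close>: on the cycle 0, the class determines \<open>y\<close>, hence \<open>x\<close>, at all edges
  but \<open>s 0\<close>; as \<open>x\<close> sums to zero around the cycle, it also determines \<open>x\<close>, hence \<open>y\<close>, at \<open>s 0\<close>; this
  fixes the coefficient of \<open>c 1\<close>, and one continues along the chain. So \<open>M\<close> injects continuously into
  a space of dimension \<open>dim (H1 E) - (p - 1)\<close>, and invariance of domain applies.
\<close>

section \<open>Local injectivity of real-analytic functions\<close>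

text \<open>If \<open>F\<close> is nonzero of subdegree \<open>n\<close>, dividing
  \<open>g h\<close> by \<open>h ^ n\<close> and filling the gap at 0 with the leading coefficient
  gives a function \<open>q\<close> that is continuous and nonzero at 0, hence nonzero
  nearby.\<close>

lemma has_fps_expansion_zero_or_isolated:
  fixes g :: "'a::{real_normed_field,banach} \<Rightarrow> 'a"
  assumes "g has_fps_expansion F"
  shows "(\<forall>\<^sub>F h in nhds 0. g h = 0) \<or> (\<forall>\<^sub>F h in at 0. g h \<noteq> 0)"
proof (cases "F = 0")
  case True
  then have "\<forall>\<^sub>F h in nhds 0. 0 = g h"
    using assms by (simp add: has_fps_expansion_def)
  then show ?thesis by (simp add: eq_commute[of 0])
next
  case False
  define n where "n = subdegree F"
  define q where "q = (\<lambda>x. if x = 0 then fps_nth F n else g x / x ^ n)"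
  have "q has_fps_expansion fps_shift n F"
    unfolding q_def by (intro has_fps_expansion_shift assms) (auto simp: n_def)
  then have "isCont q 0"
    using has_fps_expansion_imp_continuous[of q _ UNIV] by simp
  moreover have "q 0 \<noteq> 0"
    using False by (simp add: q_def n_def)
  ultimately have "\<forall>\<^sub>F h in at 0. q h \<noteq> 0"
    by (simp add: isCont_def tendsto_imp_eventually_ne)
  moreover have "\<forall>\<^sub>F h in at (0::'a). h \<noteq> 0"
    by (simp add: eventually_at_filter)
  ultimately show ?thesis
    by (intro disjI2, eventually_elim) (auto simp: q_def)
qed

lemma real_analytic_deriv_has_fps_expansion:
  assumes "real_analytic f"
  shows "\<exists>F. (\<lambda>h. deriv f (x + h)) has_fps_expansion F"
proof -
  obtain F where F: "(\<lambda>h. f (x + h)) has_fps_expansion F"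
    using assms unfolding real_analytic_def by blast
  have "deriv (\<lambda>h. f (x + h)) = (\<lambda>h. deriv f (x + h))"
  proof
    fix h
    have "(\<lambda>h. f (x + h)) = (\<lambda>h. f (h + x))" by (simp add: add.commute)
    then show "deriv (\<lambda>h. f (x + h)) h = deriv f (x + h)"
      unfolding deriv_def using DERIV_shift[of f _ h x] by (simp only: add.commute[of x h])
  qed
  then show ?thesis
    using has_fps_expansion_deriv[OF F] by auto
qed

lemma real_analytic_DERIV:
  assumes "real_analytic f"
  shows "(f has_real_derivative deriv f x) (at x)"
proof -
  obtain F where F: "(\<lambda>h. f (x + h)) has_fps_expansion F"
    using assms unfolding real_analytic_def by blast
  then have "(eval_fps F has_field_derivative eval_fps (fps_deriv F) 0) (at 0)"
    by (intro has_field_derivative_eval_fps) (auto simp: has_fps_expansion_def zero_ereal_def)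
  moreover have "\<forall>\<^sub>F h in nhds 0. eval_fps F h = f (x + h)"
    using F by (simp add: has_fps_expansion_def)
  ultimately have "((\<lambda>h. f (x + h)) has_field_derivative eval_fps (fps_deriv F) 0) (at 0)"
    by (subst (asm) DERIV_cong_ev[OF refl _ refl])
  then have "(f has_field_derivative eval_fps (fps_deriv F) 0) (at x)"
    by (subst DERIV_shift[of f _ 0 x, simplified]) (simp add: add.commute)
  then show ?thesis
    by (simp add: DERIV_imp_deriv)
qed

lemma eventually_nhds_shift:
  fixes x :: "'a::real_normed_vector"
  shows "(\<forall>\<^sub>F h in nhds 0. P (x + h)) \<longleftrightarrow> (\<forall>\<^sub>F y in nhds x. P y)"
proof -
  have "nhds x = filtermap (\<lambda>h. x + h) (nhds 0)"
    using filtermap_nhds_shift[of "- x" 0] by (simp add: add.commute)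
  then show ?thesis by (simp add: eventually_filtermap)
qed

lemma eventually_at_shift:
  fixes x :: "'a::real_normed_vector"
  shows "(\<forall>\<^sub>F h in at 0. P (x + h)) \<longleftrightarrow> (\<forall>\<^sub>F y in at x. P y)"
  by (subst (2) eventually_at_to_0) (simp add: add.commute)

text \<open>By the dichotomy for the expansion of \<open>deriv f\<close>, the set \<open>S\<close>
  of points near which the derivative vanishes identically is both open and closed. A non-isolated
  critical point would lie in \<open>S\<close>, and connectedness of the line would make
  \<open>f\<close> constant.\<close>

lemma real_analytic_critical_points_isolated:
  assumes f: "real_analytic f" and nonconst: "\<not> f constant_on UNIV"
  shows "\<forall>\<^sub>F y in at x. deriv f y \<noteq> 0"
proof (rule ccontr)
  assume neg: "\<not> ?thesis"
  define S where "S = {x. \<forall>\<^sub>F y in nhds x. deriv f y = 0}"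
  define T where "T = {x. \<forall>\<^sub>F y in at x. deriv f y \<noteq> 0}"
  have dich: "c \<in> S \<or> c \<in> T" for c
  proof -
    obtain F where "(\<lambda>h. deriv f (c + h)) has_fps_expansion F"
      using real_analytic_deriv_has_fps_expansion[OF f] by blast
    from has_fps_expansion_zero_or_isolated[OF this] show ?thesis
      unfolding S_def T_def
      using eventually_nhds_shift[of "\<lambda>y. deriv f y = 0" c]
        eventually_at_shift[of "\<lambda>y. deriv f y \<noteq> 0" c] by simp
  qed
  have "open S"
    unfolding open_subopen[of S]
    by (auto simp: S_def eventually_nhds)
  moreover have "open (- S)"
  proof (subst open_subopen, intro ballI)
    fix c assume "c \<in> - S"
    then have "\<forall>\<^sub>F y in at c. deriv f y \<noteq> 0"
      using dich T_def by blast
    then obtain U where U: "open U" "c \<in> U" "\<And>y. y \<in> U \<Longrightarrow> y \<noteq> c \<Longrightarrow> deriv f y \<noteq> 0"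
      by (auto simp: eventually_at_topological)
    have "y \<notin> S" if "y \<in> U" for y
    proof (cases "y = c")
      case False
      then show ?thesis
        using U that by (auto simp: S_def dest: eventually_nhds_x_imp_x)
    qed (use \<open>c \<in> - S\<close> in auto)
    then show "\<exists>T. open T \<and> c \<in> T \<and> T \<subseteq> - S"
      using U by blast
  qed
  moreover have "x \<in> S"
    using neg dich T_def by blast
  moreover have "connected (UNIV :: real set)" by simp
  ultimately have "S = UNIV"
    unfolding connected_clopen by (auto simp: closed_def)
  then have "deriv f y = 0" for y
    by (auto simp: S_def dest: eventually_nhds_x_imp_x)
  then have "(f has_real_derivative 0) (at y)" for y
    using real_analytic_DERIV[OF f, of y] by simp
  then have "f y = f 0" for y
    by (metis DERIV_isconst_all)
  then show False
    using nonconst by (auto simp: constant_on_def)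
qed

text \<open>The derivative is continuous at \<open>c\<close>, so it has no zero on some ball; two
  equal values of \<open>f\<close> there would contradict the mean value theorem.\<close>

lemma real_analytic_locally_injective:
  assumes f: "real_analytic f" and c: "deriv f c \<noteq> 0"
  obtains U where "open U" "c \<in> U" "inj_on f U"
proof -
  obtain F where "(\<lambda>h. deriv f (c + h)) has_fps_expansion F"
    using real_analytic_deriv_has_fps_expansion[OF f] by blast
  then have "isCont (\<lambda>h. deriv f (c + h)) 0"
    using has_fps_expansion_imp_continuous[of "\<lambda>h. deriv f (c + h)" F UNIV] by simp
  then have "\<forall>\<^sub>F h in at 0. deriv f (c + h) \<noteq> 0"
    using c by (auto simp: isCont_def intro: tendsto_imp_eventually_ne)
  then have "\<forall>\<^sub>F y in at c. deriv f y \<noteq> 0"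
    using eventually_at_shift[of "\<lambda>y. deriv f y \<noteq> 0" c] by simp
  then obtain r where r: "r > 0" "\<And>y. y \<in> ball c r \<Longrightarrow> deriv f y \<noteq> 0"
    using c by (auto simp: eventually_at dist_commute) metis
  have less: "f y \<noteq> f z" if "y \<in> ball c r" "z \<in> ball c r" "y < z" for y z
  proof
    assume eq: "f y = f z"
    obtain w where w: "y < w" "w < z" "f z - f y = (z - y) * deriv f w"
      using MVT2[OF \<open>y < z\<close>, of f "deriv f"] real_analytic_DERIV[OF f] by blast
    then have "w \<in> ball c r"
      using that by (auto simp: dist_real_def)
    then show False
      using r(2)[of w] w eq by auto
  qed
  have "inj_on f (ball c r)"
    by (rule linorder_inj_onI) (use less in auto)
  then show ?thesis
    using that[of "ball c r"] r by auto
qed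

section \<open>Shrinking an open set until \<open>f\<close> is injective on the values of given
  functions\<close>

text \<open>If \<open>g\<close> takes a noncritical value on \<open>W\<close>, a neighbourhood of
  that value on which \<open>f\<close> is injective is pulled back. Otherwise all values on
  \<open>W\<close> are critical points, which are isolated, so \<open>g\<close> is constant on a
  smaller open set and injectivity is trivial.\<close>

lemma exists_open_injective_on_image:
  assumes f: "real_analytic f" "\<not> f constant_on UNIV"
    and W: "openin X W" "W \<noteq> {}" and g: "continuous_map X euclideanreal g"
  obtains W' where "openin X W'" "W' \<noteq> {}" "W' \<subseteq> W" "inj_on f (g ` W')"
proof -
  have pre: "openin X {w \<in> W. g w \<in> U}" if "open U" for U
  proof -
    have "openin X {w \<in> topspace X. g w \<in> U}"
      using g that by (simp add: continuous_map_def)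
    moreover have "{w \<in> W. g w \<in> U} = W \<inter> {w \<in> topspace X. g w \<in> U}"
      using openin_subset[OF W(1)] by auto
    ultimately show ?thesis using W by auto
  qed
  show thesis
  proof (cases "\<exists>w\<in>W. deriv f (g w) \<noteq> 0")
    case True
    then obtain w where w: "w \<in> W" "deriv f (g w) \<noteq> 0" by blast
    obtain U where U: "open U" "g w \<in> U" "inj_on f U"
      using real_analytic_locally_injective[OF f(1) w(2)] by blast
    show thesis
    proof (rule that[OF pre[OF U(1)]])
      show "inj_on f (g ` {w \<in> W. g w \<in> U})"
        using U(3) by (rule inj_on_subset) auto
    qed (use w U in auto)
  next
    case False
    obtain w where w: "w \<in> W" using W by blast
    obtain U where U: "open U" "g w \<in> U" "\<And>y. y \<in> U \<Longrightarrow> y \<noteq> g w \<Longrightarrow> deriv f y \<noteq> 0"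
      using real_analytic_critical_points_isolated[OF f, of "g w"]
      by (auto simp: eventually_at_topological)
    have "g ` {v \<in> W. g v \<in> U} \<subseteq> {g w}"
      using U(3) False by blast
    then show thesis
      using that[OF pre[OF U(1)]] w U inj_on_subset[of f "{g w}"] by auto
  qed
qed

text \<open>Injectivity survives further shrinking, so the finitely many functions are treated one
  after another.\<close>

lemma exists_open_injective_on_images:
  assumes f: "real_analytic f" "\<not> f constant_on UNIV"
    and "finite A" and W: "openin X W" "W \<noteq> {}"
    and "\<And>a. a \<in> A \<Longrightarrow> continuous_map X euclideanreal (g a)"
  shows "\<exists>W'. openin X W' \<and> W' \<noteq> {} \<and> W' \<subseteq> W \<and> (\<forall>a\<in>A. inj_on f (g a ` W'))"
  using \<open>finite A\<close> assms(6)
proof (induction rule: finite_induct)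
  case empty
  then show ?case using W by blast
next
  case (insert a A)
  then obtain W1 where W1: "openin X W1" "W1 \<noteq> {}" "W1 \<subseteq> W" "\<forall>a\<in>A. inj_on f (g a ` W1)"
    by auto
  obtain W2 where W2: "openin X W2" "W2 \<noteq> {}" "W2 \<subseteq> W1" "inj_on f (g a ` W2)"
    using exists_open_injective_on_image[OF f W1(1,2), of "g a"] insert.prems by blast
  have "\<forall>b\<in>insert a A. inj_on f (g b ` W2)"
    using W1 W2 by (blast intro: inj_on_subset)
  then show ?case using W1 W2 by (intro exI[of _ W2]) auto
qed

section \<open>Invariance of dimension\<close>

text \<open>Points of \<open>Euclidean_space m\<close> are sequences vanishing from index
  \<open>m\<close> on. For \<open>m < d\<close> the map \<open>g\<close> therefore also goes into
  \<open>Euclidean_space d\<close>, where its image is open by invariance of domain although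
  coordinate \<open>m\<close> is zero on it.\<close>

lemma continuous_injective_Euclidean_space_dim_le:
  assumes W: "openin (Euclidean_space d) W" "W \<noteq> {}"
    and cont: "continuous_map (subtopology (Euclidean_space d) W) (Euclidean_space m) g"
    and inj: "inj_on g W"
  shows "d \<le> m"
proof (rule ccontr)
  assume "\<not> d \<le> m"
  then have md: "m < d" by simp
  have W_sub: "topspace (subtopology (Euclidean_space d) W) = W"
    using openin_subset[OF W(1)] by auto
  have im: "g ` W \<subseteq> topspace (Euclidean_space m)"
    using continuous_map_image_subset_topspace[OF cont] W_sub by simp
  have "continuous_map (subtopology (Euclidean_space d) W) (Euclidean_space d) g"
    using cont md im W_sub
    by (auto simp: Euclidean_space_def continuous_map_in_subtopology Pi_iff subset_iff)
  then have op: "openin (Euclidean_space d) (g ` W)"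
    using invariance_of_domain_Euclidean_space W(1) inj by blast
  obtain w where w: "w \<in> W" using W by blast
  \<comment> \<open>The open set \<open>g ` W\<close> would contain a segment in the direction of the coordinate \<open>m\<close>.\<close>
  define line where "line = (\<lambda>t::real. (g w)(m := t))"
  have gw: "g w i = 0" if "i \<ge> m" for i
    using im w that by (auto simp: topspace_Euclidean_space)
  have "continuous_map euclideanreal (powertop_real UNIV) line"
    unfolding continuous_map_componentwise_UNIV line_def
    by (auto simp: fun_upd_def continuous_map_id[unfolded id_def])
  then have "continuous_map euclideanreal (Euclidean_space d) line"
    unfolding Euclidean_space_def continuous_map_in_subtopology
    using md gw by (auto simp: line_def)
  then have "openin euclideanreal {t \<in> topspace euclideanreal. line t \<in> g ` W}"
    using op by (rule openin_continuous_map_preimage)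
  then have "open {t. line t \<in> g ` W}" by simp
  moreover have "{t. line t \<in> g ` W} = {0}"
  proof -
    have "line 0 = g w"
      using gw[of m] by (auto simp: line_def)
    moreover have "t = 0" if "line t \<in> g ` W" for t
    proof -
      have "line t m = 0"
        using im that by (auto simp: topspace_Euclidean_space)
      then show ?thesis by (simp add: line_def)
    qed
    ultimately show ?thesis using w by auto
  qed
  ultimately show False
    using not_open_singleton[of "0::real"] by simp
qed

section \<open>Chains of vectors with consecutively overlapping supports\<close>

text \<open>The coordinates are inner products with a basis of the orthogonal complement
  \<open>V\<close> of \<open>K\<close> in \<open>H\<close>. They are padded with zeros so that they
  form a point of \<open>Euclidean_space\<close>.\<close>

lemma subspace_quotient_coordinates:
  fixes H K :: "'a::euclidean_space set"
  assumes "subspace K" "subspace H" "K \<subseteq> H"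
  obtains \<phi> :: "'a \<Rightarrow> nat \<Rightarrow> real"
  where "\<And>i. linear (\<lambda>y. \<phi> y i)" "\<And>y i. dim H - dim K \<le> i \<Longrightarrow> \<phi> y i = 0"
    "\<And>y. y \<in> H \<Longrightarrow> (\<And>i. \<phi> y i = 0) \<Longrightarrow> y \<in> K"
proof -
  define V where "V = {y \<in> H. \<forall>x\<in>K. orthogonal x y}"
  have "subspace V"
    using \<open>subspace H\<close> unfolding V_def subspace_def
    by (auto simp: orthogonal_def inner_add_right)
  obtain B where B: "independent B" "card B = dim V" "span B = V"
    using orthogonal_basis_subspace[OF \<open>subspace V\<close>] by metis
  have dimV: "dim V = dim H - dim K"
    using dim_subspace_orthogonal_to_vectors[OF assms] unfolding V_def by linarith
  have "finite B" using B(1) by (rule independent_imp_finite)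
  then obtain b where b: "bij_betw b {..<dim V} B"
    using B(2) by (metis bij_betw_from_nat_into_finite)
  define \<phi> where "\<phi> = (\<lambda>y i. if i < dim V then b i \<bullet> y else 0)"
  show thesis
  proof
    show "linear (\<lambda>y. \<phi> y i)" for i
      by (rule linearI) (auto simp: \<phi>_def inner_add_right)
    show "\<phi> y i = 0" if "dim H - dim K \<le> i" for y i
      using that by (simp add: \<phi>_def dimV)
  next
    fix y assume y: "y \<in> H" "\<And>i. \<phi> y i = 0"
    have orth: "orthogonal y v" if "v \<in> V" for v
    proof -
      have "orthogonal y a" if "a \<in> B" for a
      proof -
        have "a \<in> b ` {..<dim V}"
          using b that by (simp add: bij_betw_def)
        then obtain i where "i < dim V" "a = b i" by blast
        then show ?thesis
          using y(2)[of i] by (simp add: \<phi>_def orthogonal_def inner_commute)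
      qed
      then show ?thesis
        using that B(3) orthogonal_to_span by blast
    qed
    \<comment> \<open>The component \<open>v\<close> of \<open>y\<close> orthogonal to
      \<open>K\<close> lies in \<open>V\<close>. Both \<open>y\<close> and \<open>k\<close> are
      orthogonal to it, so \<open>v = y - k\<close> is orthogonal to itself.\<close>
    obtain k v where kv: "k \<in> span K" "\<And>w. w \<in> span K \<Longrightarrow> orthogonal v w" "y = k + v"
      using orthogonal_subspace_decomp_exists[of K y] by metis
    have "k \<in> K" using kv(1) \<open>subspace K\<close> by (simp add: span_eq_iff[THEN iffD2])
    have "v = y - k" using kv(3) by simp
    then have "v \<in> H"
      using y(1) \<open>k \<in> K\<close> \<open>K \<subseteq> H\<close> subspace_diff[OF \<open>subspace H\<close>] by blast
    then have "v \<in> V"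
      using kv(2) by (auto simp: V_def span_base orthogonal_commute)
    then have "y \<bullet> v = 0" using orth by (simp add: orthogonal_def)
    moreover have "v \<bullet> k = 0" using kv(1,2) by (simp add: orthogonal_def)
    ultimately have "v = 0" unfolding kv(3) by (simp add: inner_add_left inner_commute[of k v])
    then show "y \<in> K" using kv(3) \<open>k \<in> K\<close> by simp
  qed
qed

lemma atLeastLessThan_eq_insert_Suc: "i < p \<Longrightarrow> {i..<p} = insert i {Suc i..<p}" for i p :: nat
  by auto

lemma span_image_component_eq_0:
  fixes c :: "'i \<Rightarrow> real ^ 'n"
  assumes "v \<in> span (c ` J)" "\<And>j. j \<in> J \<Longrightarrow> c j $ e = 0"
  shows "v $ e = 0"
proof -
  have "subspace {v :: real ^ 'n. v $ e = 0}"
    by (auto simp: subspace_def)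
  then have "span (c ` J) \<subseteq> {v. v $ e = 0}"
    using assms(2) by (intro span_minimal) auto
  then show ?thesis using assms(1) by auto
qed

text \<open>This retains from a cycle chain only the pattern of supports of its cycle vectors; signs
  are irrelevant. The value \<open>s i\<close> is constrained only for
  \<open>Suc i < p\<close>.\<close>

definition support_chain :: "nat \<Rightarrow> (nat \<Rightarrow> real ^ 'n) \<Rightarrow> (nat \<Rightarrow> 'n) \<Rightarrow> bool" where
  "support_chain p c s \<longleftrightarrow> (\<forall>i j. i < j \<longrightarrow> j < p \<longrightarrow>
     {e. c i $ e \<noteq> 0} \<inter> {e. c j $ e \<noteq> 0} = (if j = Suc i then {s i} else {}))"

lemma support_chain_disjoint:
  assumes "support_chain p c s" "i < j" "j < p" "c i $ e \<noteq> 0" "c j $ e \<noteq> 0"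
  shows "j = Suc i" "e = s i"
proof -
  have "e \<in> (if j = Suc i then {s i} else {})"
    using assms unfolding support_chain_def by blast
  then show "j = Suc i" "e = s i" by (auto split: if_splits)
qed

lemma support_chain_shared:
  assumes "support_chain p c s" "Suc i < p"
  shows "c i $ s i \<noteq> 0" "c (Suc i) $ s i \<noteq> 0"
proof -
  have "s i \<in> {e. c i $ e \<noteq> 0} \<inter> {e. c (Suc i) $ e \<noteq> 0}"
    using assms unfolding support_chain_def by (metis lessI singletonI)
  then show "c i $ s i \<noteq> 0" "c (Suc i) $ s i \<noteq> 0" by auto
qed

text \<open>The index \<open>s i\<close> belongs to the support of \<open>c i\<close>, which is
  disjoint from the supports of all vectors at least two places later.\<close>

lemma support_chain_span_vanishes:
  assumes "support_chain p c s" "Suc i < p" "v \<in> span (c ` {Suc (Suc i)..<p})"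
  shows "v $ s i = 0"
  using assms(3)
proof (rule span_image_component_eq_0)
  fix j assume "j \<in> {Suc (Suc i)..<p}"
  then show "c j $ s i = 0"
    using support_chain_disjoint[OF assms(1), of i j "s i"] support_chain_shared[OF assms(1,2)]
    by force
qed

lemma support_chain_dim_span:
  fixes c :: "nat \<Rightarrow> real ^ 'n"
  assumes "support_chain p c s"
  shows "dim (span (c ` {1..<p})) = p - 1"
proof -
  have "independent (c ` {i..<p}) \<and> card (c ` {i..<p}) = p - i" if "i \<le> p" "0 < i" for i
    using that
  proof (induction rule: inc_induct)
    case base
    then show ?case by (simp add: independent_empty)
  next
    case (step i)
    \<comment> \<open>Positivity of \<open>i\<close> provides the index \<open>s k\<close> shared
      with the preceding vector: \<open>c i\<close> is nonzero there, while the span of the later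
      vectors vanishes. No such index is available for \<open>c 0\<close>.\<close>
    then obtain k where k: "i = Suc k" using gr0_implies_Suc by blast
    have eq: "c ` {i..<p} = insert (c i) (c ` {Suc i..<p})"
      using step(2) by (simp only: atLeastLessThan_eq_insert_Suc flip: image_insert)
    have notin: "c i \<notin> span (c ` {Suc i..<p})"
    proof
      assume "c i \<in> span (c ` {Suc i..<p})"
      then have "c i $ s k = 0"
        using support_chain_span_vanishes[OF assms, of k] step(2) k by simp
      then show False
        using support_chain_shared(2)[OF assms, of k] step(2) k by simp
    qed
    then have "c i \<notin> c ` {Suc i..<p}"
      using span_superset[of "c ` {Suc i..<p}"] by (meson subsetD)
    moreover have "independent (c ` {Suc i..<p})" "card (c ` {Suc i..<p}) = p - Suc i"
      using step.IH by simp_all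
    ultimately show ?case
      unfolding eq using notin step(2) by (simp add: independent_insertI Suc_diff_Suc)
  qed
  note this[of 1]
  then show ?thesis
    unfolding dim_span by (cases "p = 0") (simp_all add: dim_eq_card_independent)
qed

text \<open>This is the reconstruction along the chain: \<open>x\<close> and \<open>x'\<close> stand
  for equilibria, \<open>y\<close> and \<open>y'\<close> for their flows, and \<open>iff\<close> for
  injectivity of \<open>f\<close> in each coordinate. The vectors \<open>c 1\<close>,
  \<open>c 2\<close>, ... are removed one by one from the span containing
  \<open>y - y'\<close>.\<close>

lemma support_chain_eqI:
  fixes x x' y y' :: "real ^ 'n"
  assumes chain: "support_chain p c s"
    and span: "y - y' \<in> span (c ` {1..<p})"
    and iff: "\<And>e. x $ e = x' $ e \<longleftrightarrow> y $ e = y' $ e"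
    and orth: "\<And>i. i < p \<Longrightarrow> orthogonal (c i) (x - x')"
  shows "x = x'"
proof -
  have peel: "y - y' \<in> span (c ` {Suc i..<p})" if "i < p" for i
    using that
  proof (induction i)
    case 0
    then show ?case using span by simp
  next
    case (Suc i)
    have "c ` {Suc i..<p} = insert (c (Suc i)) (c ` {Suc (Suc i)..<p})"
      using Suc.prems by (simp only: atLeastLessThan_eq_insert_Suc flip: image_insert)
    then have "y - y' \<in> span (insert (c (Suc i)) (c ` {Suc (Suc i)..<p}))"
      using Suc.IH Suc.prems by simp
    then have "\<exists>k. y - y' - k *\<^sub>R c (Suc i) \<in> span (c ` {Suc (Suc i)..<p})"
      by (simp only: span_breakdown_eq)
    then obtain k where k: "y - y' - k *\<^sub>R c (Suc i) \<in> span (c ` {Suc (Suc i)..<p})" ..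
    \<comment> \<open>Off \<open>s i\<close>, the support of \<open>c i\<close> meets no later
      support, so the flows agree there, and hence so do the equilibria.\<close>
    have agree: "x $ e = x' $ e" if "c i $ e \<noteq> 0" "e \<noteq> s i" for e
    proof -
      have "(y - y') $ e = 0"
      proof (rule span_image_component_eq_0)
        show "y - y' \<in> span (c ` {Suc i..<p})"
          using Suc by simp
      next
        fix j assume "j \<in> {Suc i..<p}"
        then show "c j $ e = 0"
          using support_chain_disjoint(2)[OF chain, of i j e] that by auto
      qed
      then show ?thesis by (simp add: iff)
    qed
    \<comment> \<open>Only the term at \<open>s i\<close> survives in the orthogonality relation,
      and its coefficient is nonzero.\<close>
    have "0 = (\<Sum>e\<in>UNIV. c i $ e * (x - x') $ e)"
      using orth[of i] Suc.prems by (simp add: orthogonal_def inner_vec_def)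
    also have "\<dots> = (\<Sum>e\<in>{s i}. c i $ e * (x - x') $ e)"
      using agree by (intro sum.mono_neutral_right) auto
    finally have "x $ s i = x' $ s i"
      using support_chain_shared(1)[OF chain Suc.prems] by simp
    then have "y $ s i = y' $ s i" by (simp add: iff)
    \<comment> \<open>At \<open>s i\<close> the flows agree and the later vectors vanish, so the
      coefficient \<open>k\<close> of \<open>c (Suc i)\<close> must be zero.\<close>
    moreover have "(y - y' - k *\<^sub>R c (Suc i)) $ s i = 0"
      using support_chain_span_vanishes[OF chain Suc.prems k] .
    ultimately have "k = 0"
      using support_chain_shared(2)[OF chain Suc.prems] by simp
    then show ?case using k by simp
  qed
  \<comment> \<open>At the last index, \<open>peel\<close> refers to the span of the empty
    set.\<close>
  have "y = y'"
  proof (cases p)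
    case 0
    then show ?thesis using span by simp
  next
    case (Suc q)
    then show ?thesis using peel[of q] by simp
  qed
  then show ?thesis by (simp add: iff vec_eq_iff)
qed

section \<open>Cycle vectors\<close>

text \<open>The unit flow from \<open>u\<close> to \<open>w\<close>, with the sign correcting for
  the chosen orientation. The second branch is meant for \<open>(w, u)\<close> in \<open>E\<close>,
  which \<open>orientation_cases\<close> guarantees on edges of the graph.\<close>

definition arc_vector :: "('v::finite \<times> 'v) set \<Rightarrow> 'v \<Rightarrow> 'v \<Rightarrow> real ^ ('v \<times> 'v)" where
  "arc_vector E u w = (if (u, w) \<in> E then axis (u, w) 1 else - axis (w, u) 1)"

lemma orientation_cases:
  assumes "orientation G E" "{u, w} \<in> G"
  shows "(u, w) \<in> E \<or> (w, u) \<in> E"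
proof -
  have "{u, w} \<in> (\<lambda>(j, k). {j, k}) ` E"
    using assms by (simp add: orientation_def bij_betw_def)
  then show ?thesis by (auto simp: doubleton_eq_iff)
qed

lemma orientation_inj:
  assumes "orientation G E" "e \<in> E" "e' \<in> E" "{fst e, snd e} = {fst e', snd e'}"
  shows "e = e'"
proof -
  have "inj_on (\<lambda>(j, k). {j, k}) E"
    using assms by (simp add: orientation_def bij_betw_def)
  then show ?thesis
    using assms(2-4) by (intro inj_onD[of "\<lambda>(j, k). {j, k}" E]) (auto simp: case_prod_beta)
qed

lemma incidence_matrix_arc_vector:
  assumes "orientation G E" "{u, w} \<in> G"
  shows "incidence_matrix E *v arc_vector E u w = axis w 1 - axis u 1"
proof -
  have "incidence_matrix E *v axis e 1 = axis (snd e) 1 - axis (fst e) 1" if "e \<in> E" for e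
    using that unfolding matrix_vector_mult_basis
    by (simp add: column_def incidence_matrix_def vec_eq_iff axis_def)
  moreover have "incidence_matrix E *v (- v) = - (incidence_matrix E *v v)" for v
    by (simp add: linear_neg matrix_vector_mul_linear)
  ultimately show ?thesis
    using orientation_cases[OF assms] by (auto simp: arc_vector_def)
qed

lemma arc_vector_nonzero_iff:
  assumes "orientation G E" "{u, w} \<in> G"
  shows "arc_vector E u w $ e \<noteq> 0 \<longleftrightarrow> e \<in> E \<and> {fst e, snd e} = {u, w}"
proof -
  have eq_iff: "e = a \<longleftrightarrow> e \<in> E \<and> {fst e, snd e} = {fst a, snd a}" if "a \<in> E" for a
    using orientation_inj[OF assms(1) _ that, of e] that by blast
  have axis_iff: "axis a (1::real) $ e \<noteq> 0 \<longleftrightarrow> e = a" for a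
    by (simp add: axis_def)
  show ?thesis
  proof (cases "(u, w) \<in> E")
    case True
    then show ?thesis by (simp add: arc_vector_def axis_iff eq_iff)
  next
    case False
    then have "(w, u) \<in> E" using orientation_cases[OF assms] by simp
    then show ?thesis
      using False by (simp add: arc_vector_def axis_iff eq_iff insert_commute)
  qed
qed

lemma cyclic_shift_bij:
  assumes "0 < n"
  shows "bij_betw (\<lambda>i. Suc i mod n) {..<n} {..<n}"
proof -
  have "inj_on (\<lambda>i. Suc i mod n) {..<n}"
    by (rule inj_onI) (auto simp: mod_Suc split: if_splits)
  moreover have "(\<lambda>i. Suc i mod n) ` {..<n} \<subseteq> {..<n}"
    using assms by auto
  ultimately show ?thesis
    by (simp add: bij_betw_def endo_inj_surj)
qed

text \<open>Equal edges at distinct positions would make each position the cyclic successor of the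
  other, which is impossible for length at least 3.\<close>

lemma cycle_edges_inj:
  assumes "distinct vs" "3 \<le> length vs"
  shows "inj_on (\<lambda>i. {vs ! i, vs ! (Suc i mod length vs)}) {..<length vs}"
proof (rule inj_onI)
  fix i j
  assume ij: "i \<in> {..<length vs}" "j \<in> {..<length vs}"
    and eq: "{vs ! i, vs ! (Suc i mod length vs)} = {vs ! j, vs ! (Suc j mod length vs)}"
  have "Suc k mod length vs < length vs" for k
    using assms(2) by (intro mod_less_divisor) linarith
  then have "i = j \<or> (i = Suc j mod length vs \<and> j = Suc i mod length vs)"
    using eq ij assms(1) by (auto simp: doubleton_eq_iff nth_eq_iff_index_eq)
  then show "i = j"
    using assms(2) ij by (auto simp: mod_Suc split: if_splits)
qed

text \<open>The vector is the sum of the unit flows along the arcs of the cycle. Distinct arcs use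
  distinct edges, so nothing cancels and the support is exact.\<close>

lemma cycle_vector_exists:
  assumes "orientation G E" "cycle_graph C" "C \<subseteq> G"
  obtains c where "c \<in> H1 E" "\<And>e. c $ e \<noteq> 0 \<longleftrightarrow> e \<in> E \<and> {fst e, snd e} \<in> C"
proof -
  obtain vs where vs: "distinct vs" "3 \<le> length vs"
    and C: "C = {{vs ! i, vs ! (Suc i mod length vs)} | i. i < length vs}"
    using assms(2) unfolding cycle_graph_def by blast
  define n where "n = length vs"
  then have "0 < n" using vs(2) by linarith
  define a where "a = (\<lambda>i. arc_vector E (vs ! i) (vs ! (Suc i mod n)))"
  define c where "c = (\<Sum>i<n. a i)"
  have G: "{vs ! i, vs ! (Suc i mod n)} \<in> G" if "i < n" for i
    using that assms(3) unfolding C n_def by blast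
  have a_iff: "a i $ e \<noteq> 0 \<longleftrightarrow> e \<in> E \<and> {fst e, snd e} = {vs ! i, vs ! (Suc i mod n)}"
    if "i < n" for i e
    unfolding a_def using arc_vector_nonzero_iff[OF assms(1) G[OF that]] .
  have c_iff: "c $ e \<noteq> 0 \<longleftrightarrow> e \<in> E \<and> {fst e, snd e} \<in> C" for e
  proof (cases "e \<in> E \<and> {fst e, snd e} \<in> C")
    case True
    then obtain i where i: "i < n" "{fst e, snd e} = {vs ! i, vs ! (Suc i mod n)}"
      unfolding C n_def by blast
    have "a j $ e = 0" if "j < n" "j \<noteq> i" for j
      using a_iff[OF that(1), of e] i that inj_onD[OF cycle_edges_inj[OF vs], of i j]
      by (auto simp: n_def)
    then have "c $ e = (\<Sum>j\<in>{i}. a j $ e)"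
      unfolding c_def sum_component using i(1) by (intro sum.mono_neutral_right) auto
    then show ?thesis using True i a_iff[OF i(1), of e] by simp
  next
    case False
    then have "a j $ e = 0" if "j < n" for j
      using a_iff[OF that, of e] that unfolding C n_def by blast
    then show ?thesis using False by (simp add: c_def)
  qed
  have "incidence_matrix E *v c = (\<Sum>i<n. incidence_matrix E *v a i)"
    unfolding c_def by (simp add: linear_sum matrix_vector_mul_linear)
  also have "\<dots> = (\<Sum>i<n. axis (vs ! (Suc i mod n)) 1) - (\<Sum>i<n. axis (vs ! i) 1)"
    unfolding a_def sum_subtractf[symmetric]
    using incidence_matrix_arc_vector[OF assms(1) G] by (intro sum.cong) auto
  \<comment> \<open>The cyclic shift permutes the positions, so heads and tails of the arcs
    contribute the same sum.\<close>
  also have "\<dots> = 0"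
    using sum.reindex_bij_betw[OF cyclic_shift_bij[OF \<open>0 < n\<close>],
        of "\<lambda>i. axis (vs ! i) (1::real)"]
    by simp
  finally have "c \<in> H1 E"
    using c_iff by (auto simp: H1_def edge_space_def)
  then show thesis using that c_iff by blast
qed

text \<open>An orientation matches oriented with undirected edges bijectively, so intersections of
  supports mirror intersections of the cycles; \<open>s i\<close> is the oriented form of the edge
  shared by consecutive cycles.\<close>

lemma cycle_chain_vectors:
  assumes "orientation G E" "cycle_chain Cs" "\<And>C. C \<in> set Cs \<Longrightarrow> C \<subseteq> G"
  obtains c s where "\<And>i. i < length Cs \<Longrightarrow> c i \<in> H1 E" "support_chain (length Cs) c s"
proof -
  have "\<exists>c. c \<in> H1 E \<and> (\<forall>e. c $ e \<noteq> 0 \<longleftrightarrow> e \<in> E \<and> {fst e, snd e} \<in> Cs ! i)"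
    if "i < length Cs" for i
    using that assms cycle_vector_exists[of G E "Cs ! i"]
    unfolding cycle_chain_def by (metis nth_mem)
  then obtain c where c: "\<And>i. i < length Cs \<Longrightarrow> c i \<in> H1 E"
      "\<And>i e. i < length Cs \<Longrightarrow> c i $ e \<noteq> 0 \<longleftrightarrow> e \<in> E \<and> {fst e, snd e} \<in> Cs ! i"
    by metis
  have supp: "{e. c i $ e \<noteq> 0} = {e \<in> E. {fst e, snd e} \<in> Cs ! i}" if "i < length Cs" for i
    using c(2)[OF that] by blast
  have "\<exists>e. {e. c i $ e \<noteq> 0} \<inter> {e. c (Suc i) $ e \<noteq> 0} = {e}" if i: "Suc i < length Cs" for i
  proof -
    have "card (Cs ! i \<inter> Cs ! Suc i) = 1"
      using assms(2) i unfolding cycle_chain_def by (auto dest: Suc_lessD)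
    then obtain d where d: "Cs ! i \<inter> Cs ! Suc i = {d}"
      by (auto simp: card_1_singleton_iff)
    moreover have "Cs ! i \<subseteq> G" using assms(3) i by simp
    ultimately have "d \<in> (\<lambda>(j, k). {j, k}) ` E"
      using assms(1) by (auto simp: orientation_def bij_betw_def)
    then obtain e where e: "e \<in> E" "{fst e, snd e} = d"
      by auto
    have "{e. c i $ e \<noteq> 0} \<inter> {e. c (Suc i) $ e \<noteq> 0}
        = {e \<in> E. {fst e, snd e} \<in> Cs ! i \<inter> Cs ! Suc i}"
      unfolding supp[OF i] supp[OF Suc_lessD[OF i]] by blast
    also have "\<dots> = {e}"
    proof -
      have "e' = e" if "e' \<in> E" "{fst e', snd e'} = d" for e'
        using orientation_inj[OF assms(1) that(1) e(1)] that(2) e(2) by simp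
      then show ?thesis unfolding d using e by blast
    qed
    finally show ?thesis by blast
  qed
  then obtain s where s: "\<And>i. Suc i < length Cs \<Longrightarrow>
      {e. c i $ e \<noteq> 0} \<inter> {e. c (Suc i) $ e \<noteq> 0} = {s i}"
    by metis
  have "{e. c i $ e \<noteq> 0} \<inter> {e. c j $ e \<noteq> 0} = {}"
    if "i < j" "j < length Cs" "j \<noteq> Suc i" for i j
  proof -
    have "\<bar>int i - int j\<bar> > 1" using that by linarith
    then have "Cs ! i \<inter> Cs ! j = {}"
      using assms(2) that unfolding cycle_chain_def by (meson less_trans)
    then show ?thesis unfolding supp[OF that(2)] supp[OF less_trans[OF that(1,2)]] by blast
  qed
  then have "support_chain (length Cs) c s"
    using s by (simp add: support_chain_def)
  then show thesis using that c(1) by blast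
qed

section \<open>The dimension bound\<close>

lemma subspace_H1: "subspace (H1 E)"
  by (auto simp: subspace_def H1_def edge_space_def matrix_vector_right_distrib
      matrix_vector_mult_scaleR)

text \<open>The bound for one manifold and one chain, before maxima are taken. For the empty chain,
  \<open>length Cs - 1\<close> is 0.\<close>

lemma equilibria_manifold_dim_bound:
  fixes E :: "('v::finite \<times> 'v) set"
  assumes ori: "orientation G E" and f: "real_analytic f" "\<not> f constant_on UNIV"
    and chain: "cycle_chain Cs" "\<And>C. C \<in> set Cs \<Longrightarrow> C \<subseteq> G"
    and M: "M \<subseteq> equilibria E f" "manifold_of_dim d M"
  shows "d + (length Cs - 1) \<le> dim (H1 E)"
proof -
  define p where "p = length Cs"
  obtain c s where c: "\<And>i. i < p \<Longrightarrow> c i \<in> H1 E" and supp: "support_chain p c s"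
    using cycle_chain_vectors[OF ori chain] unfolding p_def by blast
  define K where "K = span (c ` {1..<p})"
  have dimK: "dim K = p - 1"
    unfolding K_def using supp by (rule support_chain_dim_span)
  have "K \<subseteq> H1 E"
    unfolding K_def using c by (intro span_minimal subspace_H1) auto
  then have "p - 1 \<le> dim (H1 E)"
    using dim_subset dimK by metis
  \<comment> \<open>These are coordinates on the quotient of \<open>H1 E\<close> by
    \<open>K\<close>, whose dimension is \<open>dim (H1 E) - (p - 1)\<close>.\<close>
  obtain \<phi> :: "real ^ ('v \<times> 'v) \<Rightarrow> nat \<Rightarrow> real" where \<phi>: "\<And>i. linear (\<lambda>y. \<phi> y i)"
      "\<And>y i. dim (H1 E) - (p - 1) \<le> i \<Longrightarrow> \<phi> y i = 0"
      "\<And>y. y \<in> H1 E \<Longrightarrow> (\<And>i. \<phi> y i = 0) \<Longrightarrow> y \<in> K"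
    by (rule subspace_quotient_coordinates[OF subspace_span subspace_H1, of "c ` {1..<p}" E,
          folded K_def, OF \<open>K \<subseteq> H1 E\<close>, unfolded dimK])
      blast
  \<comment> \<open>A single chart suffices; it exists because \<open>M\<close> is nonempty.\<close>
  obtain x U W where UW: "x \<in> U" "openin (top_of_set M) U" "openin (Euclidean_space d) W"
      "top_of_set U homeomorphic_space subtopology (Euclidean_space d) W"
    using M(2) unfolding manifold_of_dim_def by (metis all_not_in_conv)
  have "U \<subseteq> equilibria E f"
    using UW(2) M(1) openin_imp_subset by blast
  define X where "X = subtopology (Euclidean_space d) W"
  have topX: "topspace X = W"
    using openin_subset[OF UW(3)] by (auto simp: X_def)
  obtain h where h: "homeomorphic_map X (top_of_set U) h"
    using UW(4) unfolding X_def
    by (meson homeomorphic_space homeomorphic_space_sym)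
  have hU: "h ` W = U"
    using homeomorphic_imp_surjective_map[OF h] by (simp add: topX)
  have h_inj: "inj_on h W"
    using homeomorphic_imp_injective_map[OF h] by (simp add: topX)
  have cont_h: "continuous_map X euclidean h"
    using homeomorphic_imp_continuous_map[OF h] by (rule continuous_map_into_fulltopology)
  have cont_comp: "continuous_map X euclideanreal (\<lambda>w. h w $ e)" for e
  proof -
    have "continuous_map euclidean euclideanreal (\<lambda>y :: real ^ ('v \<times> 'v). y $ e)"
      by (simp add: continuous_on_component)
    from continuous_map_compose[OF cont_h this] show ?thesis by (simp add: o_def)
  qed
  have "W \<noteq> {}" using hU UW(1) by auto
  moreover have "openin X W" using openin_topspace[of X] by (simp add: topX)
  ultimately obtain W' where W': "openin X W'" "W' \<noteq> {}" "W' \<subseteq> W"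
      "\<And>e. inj_on f ((\<lambda>w. h w $ e) ` W')"
    using exists_open_injective_on_images[OF f, of UNIV X W "\<lambda>e w. h w $ e"] cont_comp by auto
  have openW': "openin (Euclidean_space d) W'"
    using W'(1) UW(3) unfolding X_def by (rule openin_trans_full)

  \<comment> \<open>In the chart, \<open>\<psi>\<close> sends an equilibrium to the class of its
    flow modulo \<open>K\<close>.\<close>
  define \<psi> where "\<psi> = (\<lambda>w. \<phi> (edgewise E f (h w)))"
  have equi: "h w \<in> equilibria E f" if "w \<in> W'" for w
    using that W'(3) hU \<open>U \<subseteq> equilibria E f\<close> by blast
  have inj: "inj_on \<psi> W'"
  proof (rule inj_onI)
    fix w w' assume w: "w \<in> W'" "w' \<in> W'" and eq: "\<psi> w = \<psi> w'"
    have x: "h w \<in> edge_space E" "edgewise E f (h w) \<in> H1 E" "h w \<in> (H1 E)\<^sup>\<bottom>"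
      and x': "h w' \<in> edge_space E" "edgewise E f (h w') \<in> H1 E" "h w' \<in> (H1 E)\<^sup>\<bottom>"
      using equi[OF w(1)] equi[OF w(2)] by (auto simp: equilibria_def)
    have "\<phi> (edgewise E f (h w) - edgewise E f (h w')) i = 0" for i
      using fun_cong[OF eq, of i] by (simp add: \<psi>_def linear_diff[OF \<phi>(1)])
    then have "edgewise E f (h w) - edgewise E f (h w') \<in> K"
      using \<phi>(3) subspace_diff[OF subspace_H1 x(2) x'(2)] by blast
    \<comment> \<open>On \<open>E\<close> this is the injectivity arranged by the choice of
      \<open>W'\<close>; outside \<open>E\<close> all components are zero.\<close>
    moreover have "h w $ e = h w' $ e \<longleftrightarrow> edgewise E f (h w) $ e = edgewise E f (h w') $ e" for e
      using inj_on_eq_iff[OF W'(4), of "h w $ e" e "h w' $ e"] w x(1) x'(1)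
      by (cases e) (auto simp: edgewise_def edge_space_def)
    moreover have "orthogonal (c i) (h w - h w')" if "i < p" for i
      using c[OF that] x(3) x'(3) by (auto simp: orthogonal_comp_def orthogonal_clauses)
    ultimately have "h w = h w'"
      unfolding K_def by (rule support_chain_eqI[OF supp])
    then show "w = w'"
      using inj_onD[OF h_inj] w W'(3) by blast
  qed
  have cont: "continuous_map (subtopology (Euclidean_space d) W')
      (Euclidean_space (dim (H1 E) - (p - 1))) \<psi>"
  proof -
    have contf: "continuous_on UNIV f"
      using DERIV_isCont[OF real_analytic_DERIV[OF f(1)]] by (simp add: continuous_at_imp_continuous_on)
    have "continuous_on UNIV (\<lambda>y. \<phi> (edgewise E f y) i)" for i
    proof (rule continuous_on_compose2[OF linear_continuous_on[of "\<lambda>y. \<phi> y i" UNIV]])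
      show "bounded_linear (\<lambda>y. \<phi> y i)"
        using \<phi>(1) by (simp add: linear_conv_bounded_linear)
      show "continuous_on UNIV (edgewise E f)"
      proof -
        have "continuous_on UNIV (\<lambda>y :: real ^ ('v \<times> 'v). if e \<in> E then f (y $ e) else 0)" for e
          by (cases "e \<in> E") (auto intro!: continuous_on_compose2[OF contf] continuous_intros)
        then show ?thesis
          unfolding edgewise_def by (rule continuous_on_vec_lambda)
      qed
    qed auto
    then have "continuous_map X euclideanreal (\<lambda>w. \<psi> w i)" for i
      using continuous_map_compose[OF cont_h, of euclideanreal "\<lambda>y. \<phi> (edgewise E f y) i"]
      by (simp add: \<psi>_def o_def)
    then have "continuous_map X (Euclidean_space (dim (H1 E) - (p - 1))) \<psi>"
      unfolding Euclidean_space_def continuous_map_in_subtopology continuous_map_componentwise_UNIV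
      using \<phi>(2) by (auto simp: \<psi>_def)
    moreover have "subtopology (Euclidean_space d) W' = subtopology X W'"
      using W'(3) by (simp add: X_def subtopology_subtopology Int_absorb1)
    ultimately show ?thesis by (simp add: continuous_map_from_subtopology)
  qed
  have "d \<le> dim (H1 E) - (p - 1)"
    using continuous_injective_Euclidean_space_dim_le[OF openW' W'(2) cont inj] .
  then show ?thesis
    using \<open>p - 1 \<le> dim (H1 E)\<close> unfolding p_def by linarith
qed

section \<open>Witnesses of dimension 0, and passage to the maxima\<close>

lemma manifold_of_dim_0_singleton: "manifold_of_dim 0 {x}"
proof -
  have E0: "topspace (Euclidean_space 0) = {\<lambda>_. 0}"
    by (auto simp: topspace_Euclidean_space)
  have "homeomorphic_maps (top_of_set {x}) (Euclidean_space 0) (\<lambda>_ _. 0) (\<lambda>_. x)"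
    unfolding homeomorphic_maps_def by (auto simp: E0)
  then have "top_of_set {x} homeomorphic_space subtopology (Euclidean_space 0) (topspace (Euclidean_space 0))"
    unfolding subtopology_topspace homeomorphic_space_def by blast
  then show ?thesis
    unfolding manifold_of_dim_def using openin_topspace[of "Euclidean_space 0"]
    by (metis insert_not_empty openin_subtopology_self singletonD singletonI)
qed

lemma zero_in_equilibria:
  assumes "odd_function f"
  shows "0 \<in> equilibria E f"
proof -
  have "f 0 = 0" using assms unfolding odd_function_def by (metis add.inverse_neutral equal_neg_zero)
  then have "edgewise E f 0 = 0" by (simp add: edgewise_def vec_eq_iff)
  then show ?thesis
    using subspace_0[OF subspace_H1[of E]] subspace_0[OF subspace_orthogonal_comp[of "H1 E"]]
    by (simp add: equilibria_def edge_space_def)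
qed

theorem theorem3p7:
  fixes G :: "'v::finite set set"
    and E :: "('v \<times> 'v) set"
    and f :: "real \<Rightarrow> real"
  assumes "simple_graph G"
    and "orientation G E"
    and "real_analytic f"
    and "odd_function f"
    and "\<not> f constant_on UNIV"
    and "periodic_function f \<or> finite_fibers f"
  shows "int (manifold_dim (equilibria E f)) \<le> int (dim (H1 E)) - int (cc G) + 1"
proof -
  define D where "D = {d. \<exists>M. M \<subseteq> equilibria E f \<and> manifold_of_dim d M}"
  define L where "L = {length Cs | Cs. cycle_chain Cs \<and> (\<forall>C\<in>set Cs. C \<subseteq> G)}"
  have bound: "d + (l - 1) \<le> dim (H1 E)" if "d \<in> D" "l \<in> L" for d l
    using that equilibria_manifold_dim_bound[OF assms(2,3,5)] unfolding D_def L_def by blast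
  have "0 \<in> D"
    using manifold_of_dim_0_singleton[of "0 :: real ^ ('v \<times> 'v)"] zero_in_equilibria[OF assms(4), of E]
    unfolding D_def by blast
  have "0 \<in> L"
    unfolding L_def by (auto simp: cycle_chain_def intro!: exI[of _ "[]"])
  \<comment> \<open>Inserting 0 for one argument of \<open>bound\<close> bounds the other set, so
    both sets are finite and nonempty and their maxima are attained.\<close>
  have "D \<subseteq> {..dim (H1 E)}" "L \<subseteq> {..dim (H1 E) + 1}"
    using bound[OF _ \<open>0 \<in> L\<close>] bound[OF \<open>0 \<in> D\<close>] by force+
  then have "Max D \<in> D" "Max L \<in> L"
    using \<open>0 \<in> D\<close> \<open>0 \<in> L\<close> by (metis Max_in empty_iff finite_atMost finite_subset)+
  then have "Max D + (Max L - 1) \<le> dim (H1 E)" by (rule bound)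
  \<comment> \<open>Truncated subtraction is harmless: if \<open>Max L\<close> is 0, the integer
    inequality is weaker than the natural one.\<close>
  then show ?thesis
    unfolding manifold_dim_def cc_def D_def[symmetric] L_def[symmetric] by linarith
qed

end
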